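(* Let $\mathcal F=\{F_1,\dots,F_k\}$ be a family of Finsler structures on an $n$-dimensional differentiable manifold $M$ which are independent in a neighborhood $W$ of $(x_0,y_0)\in TM$ and set $F_{\max}=\max_iF_i$. Suppose that $F_i(x_0,y_0)=1$ for every $i=1,\dots,k$. Then there exist a control region $C\subset S^{n-1}$ with non-empty interior and a family of smooth unit vector fields $\{X_u,\ u\in C\}$ on a neighborhood $U$ of $x_0$ in $(M,F_{\max})$ such that $u\mapsto X_u(x)$ is a homeomorphism of $C$ onto its image in $S_{F_{\max}}[x,0,1]$ for every $x\in U$. Moreover, writing $X_u(x)=(y^1(x,u),\dots,y^n(x,u))$ in natural coordinates of $TU$ associated with a coordinate system $(x^1,\dots,x^n)$ on $U$, the maps $(x,u)\mapsto(y^1(x,u),\dots,y^n(x,u))$ and $(x,u)\mapsto(\frac{\partial y^1}{\partial x^i}(x,u),\dots,\frac{\partial y^n}{\partial x^i}(x,u))$, $i=1,\dots,n$, are continuous.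
   Context: A Finsler structure on a $C^\infty$ manifold $M$ is a continuous function $F:TM\to[0,\infty)$, $C^\infty$ on $TM\backslash0$, such that each $F(x,\cdot)$ is an asymmetric norm on $T_xM$ (vanishes only at $0$, $F(x,\lambda y)=\lambda F(x,y)$ for $\lambda>0$, subadditive) and $\frac12\frac{\partial^2F^2}{\partial y^i\partial y^j}$ is positive definite on $TM\backslash0$. $F_{\max}$ is a continuous function on $TM$ that is an asymmetric norm on each tangent space; $S_{F_{\max}}[x,0,1]=\{y\in T_xM:F_{\max}(x,y)=1\}$, and a vector field is unit if it takes values in these sets. Given $(x_0,y_0)\in TM$ with $F_i(x_0,y_0)=1$ for all $i=1,\dots,k$, the family $\mathcal F$ is independent in a neighborhood $W$ of $(x_0,y_0)$ if $\{d(F_1(x,\cdot))_y,\dots,d(F_k(x,\cdot))_y\}\subset T_x^*M$ is linearly independent for every $(x,y)\in W$, where $d(F_i(x,\cdot))_y$ is the differential of $y'\mapsto F_i(x,y')$ at $y$. $S^{n-1}$ denotes the unit sphere of $\mathbb R^n$ centered at the origin (the paper takes it here with respect to the maximum norm, $S^{n-1}=\{z\in\mathbb R^n:\max_i|z^i|=1\}$); "interior" is relative to $S^{n-1}$. *)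

theory Defs
  imports "HOL-Analysis.Analysis"
begin

section \<open>Smooth maps between Euclidean spaces\<close>

text \<open>Meaningful for open \<open>S\<close> only.\<close>

primrec Ck_on :: "nat \<Rightarrow> ('a::euclidean_space \<Rightarrow> 'b::real_normed_vector) \<Rightarrow> 'a set \<Rightarrow> bool" where
  "Ck_on 0 f S \<longleftrightarrow> continuous_on S f"
| "Ck_on (Suc r) f S \<longleftrightarrow> (\<forall>x\<in>S. f differentiable (at x)) \<and>
     (\<forall>v. Ck_on r (\<lambda>x. frechet_derivative f (at x) v) S)"

definition smooth_on :: "('a::euclidean_space \<Rightarrow> 'b::real_normed_vector) \<Rightarrow> 'a set \<Rightarrow> bool" where
  "smooth_on f S \<longleftrightarrow> (\<forall>r. Ck_on r f S)"

text \<open>For differentiable \<open>f\<close>, the Frechet derivative in the direction of the \<open>i\<close>-th unit vector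
  is the usual partial derivative.\<close>

definition partial_deriv :: "'n \<Rightarrow> (real^'n \<Rightarrow> 'b::real_normed_vector) \<Rightarrow> real^'n \<Rightarrow> 'b" where
  "partial_deriv i f x = frechet_derivative f (at x) (axis i 1)"

definition hessian :: "(real^'n \<Rightarrow> real) \<Rightarrow> real^'n \<Rightarrow> real^'n^'n" where
  "hessian f x = (\<chi> i j. partial_deriv i (partial_deriv j f) x)"

definition positive_definite :: "real^'n^'n \<Rightarrow> bool" where
  "positive_definite H \<longleftrightarrow> (\<forall>v. v \<noteq> 0 \<longrightarrow> v \<bullet> (H *v v) > 0)"


section \<open>Smooth manifolds\<close>

text \<open>A chart is its domain together with its coordinate map; the values of the map outside the
  domain are irrelevant.\<close>

type_synonym ('a, 'n) chart = "'a set \<times> ('a \<Rightarrow> real^'n)"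

definition chart_on :: "'a topology \<Rightarrow> ('a, 'n::finite) chart \<Rightarrow> bool" where
  "chart_on M c \<longleftrightarrow> openin M (fst c) \<and> open (snd c ` fst c) \<and>
     homeomorphic_map (subtopology M (fst c)) (top_of_set (snd c ` fst c)) (snd c)"

definition chart_inv :: "('a, 'n::finite) chart \<Rightarrow> real^'n \<Rightarrow> 'a" where
  "chart_inv c = inv_into (fst c) (snd c)"

definition transition :: "('a, 'n::finite) chart \<Rightarrow> ('a, 'n) chart \<Rightarrow> real^'n \<Rightarrow> real^'n" where
  "transition c d = snd d \<circ> chart_inv c"

definition compatible_charts :: "('a, 'n::finite) chart \<Rightarrow> ('a, 'n) chart \<Rightarrow> bool" where
  "compatible_charts c d \<longleftrightarrow>
     smooth_on (transition c d) (snd c ` (fst c \<inter> fst d)) \<and>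
     smooth_on (transition d c) (snd d ` (fst c \<inter> fst d))"

text \<open>The dimension is \<open>CARD('n)\<close>. The smooth structure \<open>A\<close> is a maximal atlas, so that its elements
  are exactly the smooth coordinate systems of the manifold.\<close>

definition smooth_manifold :: "'a topology \<Rightarrow> ('a, 'n::finite) chart set \<Rightarrow> bool" where
  "smooth_manifold M A \<longleftrightarrow>
     Hausdorff_space M \<and> second_countable M \<and>
     (\<forall>c\<in>A. chart_on M c) \<and> \<Union>(fst ` A) = topspace M \<and>
     (\<forall>c\<in>A. \<forall>d\<in>A. compatible_charts c d) \<and>
     (\<forall>c. chart_on M c \<and> (\<forall>d\<in>A. compatible_charts c d) \<longrightarrow> c \<in> A)"


section \<open>The tangent bundle\<close>

text \<open>A tangent vector at \<open>p\<close> is the family of its component vectors with respect to all charts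
  around \<open>p\<close>, subject to the transformation law \<open>v\<^sub>d = D(d \<circ> c\<inverse>) v\<^sub>c\<close>; the components in all other
  charts are set to 0. The vector space operations are pointwise.\<close>

type_synonym ('a, 'n) tvec = "('a, 'n) chart \<Rightarrow> real^'n"

definition tangent_space :: "('a, 'n::finite) chart set \<Rightarrow> 'a \<Rightarrow> ('a, 'n) tvec set" where
  "tangent_space A p = {v.
     (\<forall>c\<in>A. \<forall>d\<in>A. p \<in> fst c \<inter> fst d \<longrightarrow>
        v d = frechet_derivative (transition c d) (at (snd c p)) (v c)) \<and>
     (\<forall>c. \<not> (c \<in> A \<and> p \<in> fst c) \<longrightarrow> v c = 0)}"

definition tangent_bundle ::
    "'a topology \<Rightarrow> ('a, 'n::finite) chart set \<Rightarrow> ('a \<times> ('a, 'n) tvec) set" where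
  "tangent_bundle M A = Sigma (topspace M) (tangent_space A)"

definition natural_coords ::
    "('a, 'n::finite) chart \<Rightarrow> 'a \<times> ('a, 'n) tvec \<Rightarrow> (real^'n) \<times> (real^'n)" where
  "natural_coords c z = (snd c (fst z), snd z c)"

definition tangent_topology ::
    "'a topology \<Rightarrow> ('a, 'n::finite) chart set \<Rightarrow> ('a \<times> ('a, 'n) tvec) topology" where
  "tangent_topology M A = topology_generated_by
     {{z \<in> tangent_bundle M A. fst z \<in> fst c \<and> natural_coords c z \<in> O'} | c O'. c \<in> A \<and> open O'}"

text \<open>The tangent vector at \<open>p\<close> with components \<open>w\<close> in the chart \<open>c\<close>.\<close>

definition tvec_of :: "('a, 'n::finite) chart set \<Rightarrow> ('a, 'n) chart \<Rightarrow> 'a \<Rightarrow> real^'n \<Rightarrow> ('a, 'n) tvec" where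
  "tvec_of A c p = inv_into (tangent_space A p) (\<lambda>v. v c)"

text \<open>A function on the tangent bundle, expressed in natural coordinates \<open>(x, y)\<close>.\<close>

definition local_rep ::
    "('a, 'n::finite) chart set \<Rightarrow> ('a, 'n) chart \<Rightarrow> ('a \<times> ('a, 'n) tvec \<Rightarrow> real) \<Rightarrow>
     (real^'n) \<times> (real^'n) \<Rightarrow> real" where
  "local_rep A c F = (\<lambda>(x, y). F (chart_inv c x, tvec_of A c (chart_inv c x) y))"

text \<open>\<open>L\<close> is the differential at \<open>y\<close> of the function \<open>f\<close> on the vector space \<open>T\<^sub>pM\<close>. The space is
  identified with Euclidean space by the linear coordinates that a chart induces on it.\<close>

definition has_fibre_differential ::
    "('a, 'n::finite) chart set \<Rightarrow> 'a \<Rightarrow> (('a, 'n) tvec \<Rightarrow> real) \<Rightarrow> (('a, 'n) tvec \<Rightarrow> real) \<Rightarrow>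
     ('a, 'n) tvec \<Rightarrow> bool" where
  "has_fibre_differential A p f L y \<longleftrightarrow>
     (\<forall>c\<in>A. p \<in> fst c \<longrightarrow>
        ((\<lambda>w. f (tvec_of A c p w)) has_derivative (\<lambda>w. L (tvec_of A c p w))) (at (y c)))"

definition field_coords :: "('a, 'n::finite) chart \<Rightarrow> ('a \<Rightarrow> ('a, 'n) tvec) \<Rightarrow> real^'n \<Rightarrow> real^'n" where
  "field_coords c X x = X (chart_inv c x) c"

definition smooth_vector_field ::
    "('a, 'n::finite) chart set \<Rightarrow> 'a set \<Rightarrow> ('a \<Rightarrow> ('a, 'n) tvec) \<Rightarrow> bool" where
  "smooth_vector_field A U X \<longleftrightarrow>
     (\<forall>p\<in>U. X p \<in> tangent_space A p) \<and>
     (\<forall>c\<in>A. smooth_on (field_coords c X) (snd c ` (U \<inter> fst c)))"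


section \<open>Finsler structures\<close>

definition asymmetric_norm_on :: "('a, 'n::finite) tvec set \<Rightarrow> (('a, 'n) tvec \<Rightarrow> real) \<Rightarrow> bool" where
  "asymmetric_norm_on V f \<longleftrightarrow>
     (\<forall>y\<in>V. f y \<ge> 0 \<and> (f y = 0 \<longleftrightarrow> y = (\<lambda>_. 0))) \<and>
     (\<forall>y\<in>V. \<forall>t>0. f (\<lambda>c. t *\<^sub>R y c) = t * f y) \<and>
     (\<forall>y\<in>V. \<forall>z\<in>V. f (\<lambda>c. y c + z c) \<le> f y + f z)"

definition finsler_structure ::
    "'a topology \<Rightarrow> ('a, 'n::finite) chart set \<Rightarrow> ('a \<times> ('a, 'n) tvec \<Rightarrow> real) \<Rightarrow> bool" where
  "finsler_structure M A F \<longleftrightarrow>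
     continuous_map (tangent_topology M A) euclideanreal F \<and>
     (\<forall>c\<in>A. smooth_on (local_rep A c F) ((snd c ` fst c) \<times> (- {0}))) \<and>
     (\<forall>p\<in>topspace M. asymmetric_norm_on (tangent_space A p) (\<lambda>y. F (p, y))) \<and>
     (\<forall>c\<in>A. \<forall>x \<in> snd c ` fst c. \<forall>y. y \<noteq> 0 \<longrightarrow>
        positive_definite ((1/2) *\<^sub>R hessian (\<lambda>y'. (local_rep A c F (x, y'))\<^sup>2) y))"

definition finsler_max :: "(nat \<Rightarrow> 'z \<Rightarrow> real) \<Rightarrow> nat \<Rightarrow> 'z \<Rightarrow> real" where
  "finsler_max F k z = (MAX i\<in>{1..k}. F i z)"

definition unit_tangent_sphere ::
    "('a, 'n::finite) chart set \<Rightarrow> ('a \<times> ('a, 'n) tvec \<Rightarrow> real) \<Rightarrow> 'a \<Rightarrow> ('a \<times> ('a, 'n) tvec) set" where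
  "unit_tangent_sphere A F p = {(p, y) | y. y \<in> tangent_space A p \<and> F (p, y) = 1}"

text \<open>Independence is that of the family (not merely the set) of the \<open>k\<close> differentials; the
  differentials are required to exist at the points of \<open>W\<close>.\<close>

definition finsler_independent ::
    "('a, 'n::finite) chart set \<Rightarrow> (nat \<Rightarrow> 'a \<times> ('a, 'n) tvec \<Rightarrow> real) \<Rightarrow> nat \<Rightarrow>
     ('a \<times> ('a, 'n) tvec) set \<Rightarrow> bool" where
  "finsler_independent A F k W \<longleftrightarrow>
     (\<forall>(p, y)\<in>W. \<exists>L.
        (\<forall>i\<in>{1..k}. has_fibre_differential A p (\<lambda>y'. F i (p, y')) (L i) y) \<and>
        (\<forall>a. (\<forall>v\<in>tangent_space A p. (\<Sum>i=1..k. a i * L i v) = 0) \<longrightarrow> (\<forall>i\<in>{1..k}. a i = 0)))"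

definition max_sphere :: "(real^'n) set" where
  "max_sphere = {z. infnorm z = 1}"

end

theory Submission
  imports Defs
begin

text \<open>No inverse function theorem is needed, since the control region may be any open piece of the
  sphere. The differentials of the \<open>F\<^sub>i\<close> at \<open>y\<^sub>0\<close> are pairwise distinct and all \<open>F\<^sub>i\<close> agree there, so
  moving from \<open>y\<^sub>0\<close> along a gradient of maximal norm leads to a direction \<open>u\<^sub>1\<close> in which one \<open>F\<^sub>i\<close>
  strictly exceeds all the others. By continuity and homogeneity \<open>F\<^sub>m\<^sub>a\<^sub>x = F\<^sub>i\<close> for base points near
  \<open>x\<^sub>0\<close> and directions \<open>u\<close> near \<open>u\<^sub>1\<close>, and \<open>X\<^sub>u = u / F\<^sub>i(\<cdot>, u)\<close>, with \<open>u\<close> constant in a fixed chart,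
  is a smooth unit field that depends smoothly on \<open>u\<close>; normalising by the maximum norm recovers \<open>u\<close>.\<close>

section \<open>Calculus of smooth maps\<close>

text \<open>On an open \<open>S\<close> the derivative at a point sees only values inside
  \<open>S\<close>. So \<open>g\<close> and \<open>h\<close> have the same derivatives throughout
  \<open>S\<close>, and the induction repeats the argument for these, which is why both functions
  are generalised.\<close>

lemma Ck_on_cong:
  assumes "open S" "Ck_on r g S" "\<And>x. x \<in> S \<Longrightarrow> g x = h x"
  shows "Ck_on r h S"
  using assms(2,3)
proof (induction r arbitrary: g h)
  case 0
  then show ?case
    using continuous_on_cong[of S S g h] by simp
next
  case (Suc r)
  have h': "(h has_derivative frechet_derivative g (at x)) (at x)" if "x \<in> S" for x
    using Suc.prems that assms(1) has_derivative_transform_within_open[of g _ x UNIV S h]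
    by (auto simp: frechet_derivative_works)
  then have "frechet_derivative g (at x) v = frechet_derivative h (at x) v" if "x \<in> S" for x v
    using that frechet_derivative_at by metis
  then have "Ck_on r (\<lambda>x. frechet_derivative h (at x) v) S" for v
    using Suc.IH[of "\<lambda>x. frechet_derivative g (at x) v"] Suc.prems(1) by simp
  then show ?case
    using differentiableI[OF h'] by simp
qed

text \<open>Allows the derivative to be named by a formula: by uniqueness it agrees on
  \<open>S\<close> with the value chosen by \<open>frechet_derivative\<close>, and
  \<open>Ck_on_cong\<close> transfers regularity. All rules below go through this.\<close>

lemma Ck_on_SucI:
  assumes "open S" "\<And>x. x \<in> S \<Longrightarrow> (f has_derivative f' x) (at x)"
    and "\<And>v. Ck_on r (\<lambda>x. f' x v) S"
  shows "Ck_on (Suc r) f S"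
  unfolding Ck_on.simps
proof (intro conjI ballI allI)
  fix x assume "x \<in> S"
  then show "f differentiable at x"
    using assms(2) differentiableI by blast
next
  fix v
  have "f' x v = frechet_derivative f (at x) v" if "x \<in> S" for x
    using assms(2)[OF that] frechet_derivative_at by metis
  then show "Ck_on r (\<lambda>x. frechet_derivative f (at x) v) S"
    by (rule Ck_on_cong[OF assms(1,3)])
qed

lemma Ck_on_subset: "Ck_on r f S \<Longrightarrow> T \<subseteq> S \<Longrightarrow> Ck_on r f T"
  by (induction r arbitrary: f) (auto intro: continuous_on_subset)

lemma Ck_on_SucD: "Ck_on (Suc r) f S \<Longrightarrow> Ck_on r f S"
proof (induction r arbitrary: f)
  case 0
  then show ?case
    by (auto intro!: continuous_at_imp_continuous_on differentiable_imp_continuous_within)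
next
  case (Suc r)
  then show ?case
    by (metis Ck_on.simps(2))
qed

lemma Ck_on_const: "open S \<Longrightarrow> Ck_on r (\<lambda>x. c) S"
proof (induction r arbitrary: c)
  case (Suc r)
  then show ?case
    by (intro Ck_on_SucI[where f' = "\<lambda>x v. 0"]) auto
qed auto

lemma Ck_on_bounded_linear: "open S \<Longrightarrow> bounded_linear f \<Longrightarrow> Ck_on r f S"
proof (cases r)
  case (Suc r)
  assume "open S" "bounded_linear f"
  then show ?thesis
    unfolding Suc
    by (intro Ck_on_SucI[where f' = "\<lambda>x v. f v"] Ck_on_const bounded_linear_imp_has_derivative)
qed (auto simp: linear_continuous_on)

lemma Ck_on_add:
  assumes "open S" "Ck_on r f S" "Ck_on r g S"
  shows "Ck_on r (\<lambda>x. f x + g x) S"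
  using assms(2,3)
proof (induction r arbitrary: f g)
  case (Suc r)
  show ?case
    by (rule Ck_on_SucI[where f' = "\<lambda>x v. frechet_derivative f (at x) v + frechet_derivative g (at x) v"])
      (use Suc assms(1) in \<open>auto intro!: has_derivative_add simp: frechet_derivative_works[symmetric]\<close>)
qed (auto intro: continuous_on_add)

lemma Ck_on_sum:
  assumes "open S" "\<And>i. i \<in> I \<Longrightarrow> Ck_on r (f i) S"
  shows "Ck_on r (\<lambda>x. \<Sum>i\<in>I. f i x) S"
  using assms(2)
  by (induction I rule: infinite_finite_induct) (auto intro: Ck_on_const Ck_on_add assms(1))

text \<open>The Leibniz formula contains \<open>f\<close> and \<open>g\<close> undifferentiated, so
  both must first be lowered by one order with \<open>Ck_on_SucD\<close> before the induction
  hypothesis applies.\<close>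

lemma Ck_on_scaleR:
  assumes "open S" "Ck_on r f S" "Ck_on r g S"
  shows "Ck_on r (\<lambda>x. f x *\<^sub>R g x) S"
  using assms(2,3)
proof (induction r arbitrary: f g)
  case (Suc r)
  show ?case
  proof (rule Ck_on_SucI[where f' = "\<lambda>x v. f x *\<^sub>R frechet_derivative g (at x) v + frechet_derivative f (at x) v *\<^sub>R g x"])
    show "Ck_on r (\<lambda>x. f x *\<^sub>R frechet_derivative g (at x) v + frechet_derivative f (at x) v *\<^sub>R g x) S" for v
      using Suc.prems Ck_on_SucD[OF Suc.prems(1)] Ck_on_SucD[OF Suc.prems(2)]
      by (intro Ck_on_add assms(1) Suc.IH) auto
  qed (use Suc assms(1) in \<open>auto intro!: has_derivative_scaleR simp: frechet_derivative_works[symmetric]\<close>)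
qed (auto intro: continuous_on_scaleR)

lemma Ck_on_bounded_linear_compose:
  assumes "open S" "bounded_linear L" "Ck_on r f S"
  shows "Ck_on r (\<lambda>x. L (f x)) S"
  using assms(3)
proof (induction r arbitrary: f)
  case 0
  then show ?case
    using linear_continuous_on[OF assms(2)] by (auto intro: continuous_on_compose2)
next
  case (Suc r)
  show ?case
    by (rule Ck_on_SucI[where f' = "\<lambda>x v. L (frechet_derivative f (at x) v)"])
      (use Suc assms(1) in \<open>auto intro!: bounded_linear.has_derivative[OF assms(2)] simp: frechet_derivative_works[symmetric]\<close>)
qed

text \<open>In the chain rule the outer derivative is taken in a direction that moves with
  \<open>x\<close>, while \<open>Ck_on\<close> controls derivatives in fixed directions only.
  Expanding that direction in the standard basis gives a finite sum of scalar factors times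
  \<open>?g' (f x) b\<close>; the latter is again a composite with \<open>f\<close>, of lower
  order.\<close>

lemma Ck_on_compose:
  fixes f :: "'a::euclidean_space \<Rightarrow> 'b::euclidean_space" and g :: "'b \<Rightarrow> 'c::real_normed_vector"
  assumes "open S" "Ck_on r f S" "Ck_on r g T" "f ` S \<subseteq> T"
  shows "Ck_on r (\<lambda>x. g (f x)) S"
  using assms(2,3)
proof (induction r arbitrary: g)
  case 0
  then show ?case
    using assms(4) by (auto intro: continuous_on_compose2)
next
  case (Suc r)
  let ?f' = "\<lambda>x. frechet_derivative f (at x)" and ?g' = "\<lambda>y. frechet_derivative g (at y)"
  show ?case
  proof (rule Ck_on_SucI[OF assms(1)])
    fix x assume x: "x \<in> S"
    then have f': "(f has_derivative ?f' x) (at x)" and g': "(g has_derivative ?g' (f x)) (at (f x))"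
      using Suc.prems assms(4) by (auto simp: image_subset_iff simp flip: frechet_derivative_works)
    interpret g': linear "?g' (f x)"
      using g' by (rule has_derivative_linear)
    have "?g' (f x) w = (\<Sum>b\<in>Basis. (w \<bullet> b) *\<^sub>R ?g' (f x) b)" for w
    proof -
      have "?g' (f x) w = ?g' (f x) (\<Sum>b\<in>Basis. (w \<bullet> b) *\<^sub>R b)"
        by (simp only: euclidean_representation)
      then show ?thesis
        by (simp only: g'.sum g'.scale)
    qed
    then show "((\<lambda>x. g (f x)) has_derivative (\<lambda>v. \<Sum>b\<in>Basis. (?f' x v \<bullet> b) *\<^sub>R ?g' (f x) b)) (at x)"
      by (intro has_derivative_eq_rhs[OF has_derivative_compose[OF f' g']] ext)
  next
    fix v
    have "Ck_on r (\<lambda>x. ?f' x v \<bullet> b) S" for b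
      using Suc.prems by - (rule Ck_on_bounded_linear_compose[OF assms(1) bounded_linear_inner_left], simp)
    moreover have "Ck_on r (\<lambda>x. ?g' (f x) b) S" for b
      using Suc.prems(2) by - (rule Suc.IH[OF Ck_on_SucD[OF Suc.prems(1)]], simp)
    ultimately show "Ck_on r (\<lambda>x. \<Sum>b\<in>Basis. (?f' x v \<bullet> b) *\<^sub>R ?g' (f x) b) S"
      by (intro Ck_on_sum Ck_on_scaleR assms(1))
  qed
qed

text \<open>The derivative of \<open>1/f\<close> is a product of \<open>f'\<close> and two copies of
  \<open>1/f\<close> itself, which the induction hypothesis covers. Sign and products are written as
  nested scalings so that \<open>Ck_on_scaleR\<close> handles them.\<close>

lemma Ck_on_inverse:
  fixes f :: "'a::euclidean_space \<Rightarrow> real"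
  assumes "open S" "Ck_on r f S" "\<And>x. x \<in> S \<Longrightarrow> f x \<noteq> 0"
  shows "Ck_on r (\<lambda>x. inverse (f x)) S"
  using assms(2)
proof (induction r)
  case 0
  then show ?case
    using assms(3) by (auto intro: continuous_on_inverse)
next
  case (Suc r)
  have "Ck_on r (\<lambda>x. inverse (f x)) S" 
    using Suc Ck_on_SucD by blast
  then have "Ck_on r (\<lambda>x. - 1 *\<^sub>R (inverse (f x) *\<^sub>R (frechet_derivative f (at x) v *\<^sub>R inverse (f x)))) S" for v
    using Suc.prems by (intro Ck_on_scaleR assms(1) Ck_on_const) auto
  then have "Ck_on r (\<lambda>x. - (inverse (f x) * frechet_derivative f (at x) v * inverse (f x))) S" for v
    by (simp add: mult.assoc)
  then show ?case
    by (intro Ck_on_SucI[where f' = "\<lambda>x v. - (inverse (f x) * frechet_derivative f (at x) v * inverse (f x))"] assms)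
      (use Suc.prems assms in \<open>auto intro!: has_derivative_inverse simp: frechet_derivative_works[symmetric]\<close>)
qed

section \<open>Rules for smooth maps, obtained order by order\<close>

lemma smooth_on_cong:
  "open S \<Longrightarrow> smooth_on g S \<Longrightarrow> (\<And>x. x \<in> S \<Longrightarrow> g x = h x) \<Longrightarrow> smooth_on h S"
  unfolding smooth_on_def using Ck_on_cong[of S _ g h] by blast

lemma smooth_on_subset: "smooth_on f S \<Longrightarrow> T \<subseteq> S \<Longrightarrow> smooth_on f T"
  unfolding smooth_on_def using Ck_on_subset by blast

lemma smooth_on_bounded_linear: "open S \<Longrightarrow> bounded_linear f \<Longrightarrow> smooth_on f S"
  unfolding smooth_on_def using Ck_on_bounded_linear by blast

lemma smooth_on_bounded_linear_compose:
  "open S \<Longrightarrow> bounded_linear L \<Longrightarrow> smooth_on f S \<Longrightarrow> smooth_on (\<lambda>x. L (f x)) S"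
  unfolding smooth_on_def using Ck_on_bounded_linear_compose[of S L _ f] by blast

lemma smooth_on_sum:
  "open S \<Longrightarrow> (\<And>i. i \<in> I \<Longrightarrow> smooth_on (f i) S) \<Longrightarrow> smooth_on (\<lambda>x. \<Sum>i\<in>I. f i x) S"
  unfolding smooth_on_def using Ck_on_sum[of S I _ f] by blast

lemma smooth_on_scaleR:
  "open S \<Longrightarrow> smooth_on f S \<Longrightarrow> smooth_on g S \<Longrightarrow> smooth_on (\<lambda>x. f x *\<^sub>R g x) S"
  unfolding smooth_on_def using Ck_on_scaleR[of S _ f g] by blast

lemma smooth_on_compose:
  fixes f :: "'a::euclidean_space \<Rightarrow> 'b::euclidean_space" and g :: "'b \<Rightarrow> 'c::real_normed_vector"
  shows "open S \<Longrightarrow> smooth_on f S \<Longrightarrow> smooth_on g T \<Longrightarrow> f ` S \<subseteq> T \<Longrightarrow> smooth_on (\<lambda>x. g (f x)) S"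
  unfolding smooth_on_def using Ck_on_compose[of S _ f g T] by blast

lemma smooth_on_inverse:
  fixes f :: "'a::euclidean_space \<Rightarrow> real"
  shows "open S \<Longrightarrow> smooth_on f S \<Longrightarrow> (\<And>x. x \<in> S \<Longrightarrow> f x \<noteq> 0) \<Longrightarrow> smooth_on (\<lambda>x. inverse (f x)) S"
  unfolding smooth_on_def using Ck_on_inverse[of S _ f] by blast

lemma smooth_on_imp_continuous_on: "smooth_on f S \<Longrightarrow> continuous_on S f"
  unfolding smooth_on_def using Ck_on.simps(1) by blast

lemma smooth_on_has_derivative:
  "smooth_on f S \<Longrightarrow> x \<in> S \<Longrightarrow> (f has_derivative frechet_derivative f (at x)) (at x)"
  unfolding smooth_on_def using Ck_on.simps(2)[of 0 f S] frechet_derivative_works by blast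

lemma smooth_on_frechet_derivative:
  "smooth_on f S \<Longrightarrow> smooth_on (\<lambda>x. frechet_derivative f (at x) v) S"
  unfolding smooth_on_def using Ck_on.simps(2) by blast

text \<open>A pair is the sum of \<open>(f x, 0)\<close> and \<open>(0, g x)\<close>, each a bounded
  linear image of a smooth map.\<close>

lemma smooth_on_Pair:
  fixes f :: "'a::euclidean_space \<Rightarrow> 'b::euclidean_space" and g :: "'a \<Rightarrow> 'c::euclidean_space"
  assumes "open S" "smooth_on f S" "smooth_on g S"
  shows "smooth_on (\<lambda>x. (f x, g x)) S"
proof -
  have "Ck_on r (\<lambda>x. (f x, 0::'c)) S" for r
    using assms(2) unfolding smooth_on_def
    by - (rule Ck_on_bounded_linear_compose[OF assms(1)], auto intro: bounded_linear_Pair bounded_linear_ident bounded_linear_zero)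
  moreover have "Ck_on r (\<lambda>x. (0::'b, g x)) S" for r
    using assms(3) unfolding smooth_on_def
    by - (rule Ck_on_bounded_linear_compose[OF assms(1)], auto intro: bounded_linear_Pair bounded_linear_ident bounded_linear_zero)
  ultimately show ?thesis
    unfolding smooth_on_def using Ck_on_add[OF assms(1), of _ "\<lambda>x. (f x, 0)" "\<lambda>x. (0, g x)"] by simp
qed

lemma smooth_on_const: "open S \<Longrightarrow> smooth_on (\<lambda>x. c) S"
  unfolding smooth_on_def using Ck_on_const by blast

section \<open>Slices of jointly smooth maps\<close>

lemma smooth_on_slice:
  fixes H :: "'a::euclidean_space \<times> 'b::euclidean_space \<Rightarrow> 'c::real_normed_vector"
  assumes "open S" "smooth_on H (S \<times> B)" "u \<in> B"
  shows "smooth_on (\<lambda>x. H (x, u)) S"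
proof (rule smooth_on_compose[OF assms(1) _ assms(2)])
  show "smooth_on (\<lambda>x. (x, u)) S"
    using assms(1) by (intro smooth_on_Pair smooth_on_const smooth_on_bounded_linear bounded_linear_ident)
qed (use assms(3) in auto)

text \<open>The partial derivative of a slice is the total derivative of \<open>H\<close> in the
  fixed direction \<open>(axis i 1, 0)\<close>, and that is smooth in both variables
  together.\<close>

lemma continuous_on_partial_deriv_slice:
  fixes H :: "(real^'n) \<times> 'b::euclidean_space \<Rightarrow> 'c::real_normed_vector"
  assumes "smooth_on H (S \<times> B)"
  shows "continuous_on (S \<times> B) (\<lambda>(x, u). partial_deriv i (\<lambda>x. H (x, u)) x)"
proof -
  have "partial_deriv i (\<lambda>x. H (x, u)) x = frechet_derivative H (at (x, u)) (axis i 1, 0)"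
    if "x \<in> S" "u \<in> B" for x u
  proof -
    have 1: "((\<lambda>x. (x, u)) has_derivative (\<lambda>v. (v, 0))) (at x)"
      by (auto intro!: derivative_eq_intros)
    have "(H has_derivative frechet_derivative H (at (x, u))) (at (x, u))"
      using smooth_on_has_derivative[OF assms] that by auto
    from has_derivative_compose[OF 1 this]
    show ?thesis
      unfolding partial_deriv_def using frechet_derivative_at by metis
  qed
  moreover have "continuous_on (S \<times> B) (\<lambda>z. frechet_derivative H (at z) (axis i 1, 0))"
    using assms by (intro smooth_on_imp_continuous_on smooth_on_frechet_derivative)
  ultimately show ?thesis
    by (auto intro!: continuous_on_eq[where g = "\<lambda>(x, u). partial_deriv i (\<lambda>x. H (x, u)) x"])
qed


section \<open>Charts and tangent vectors\<close>

locale manifold =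
  fixes M :: "'a topology" and A :: "('a, 'n::finite) chart set"
  assumes smooth_manifold: "smooth_manifold M A"
begin

lemma chart_on: "c \<in> A \<Longrightarrow> chart_on M c"
  using smooth_manifold by (auto simp: smooth_manifold_def)

lemma openin_chart: "c \<in> A \<Longrightarrow> openin M (fst c)"
  using chart_on by (auto simp: chart_on_def)

lemma chart_subset: "c \<in> A \<Longrightarrow> fst c \<subseteq> topspace M"
  using openin_subset[OF openin_chart] .

lemma chart_homeomorphic:
  "c \<in> A \<Longrightarrow> homeomorphic_map (subtopology M (fst c)) (top_of_set (snd c ` fst c)) (snd c)"
  using chart_on by (auto simp: chart_on_def)

lemma chart_inj: "c \<in> A \<Longrightarrow> inj_on (snd c) (fst c)"
  using homeomorphic_imp_injective_map[OF chart_homeomorphic] chart_subset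
  by (simp add: Int_absorb1)

lemma chart_inv_left [simp]: "c \<in> A \<Longrightarrow> p \<in> fst c \<Longrightarrow> chart_inv c (snd c p) = p"
  unfolding chart_inv_def using chart_inj by simp

lemma transition_apply [simp]: "c \<in> A \<Longrightarrow> p \<in> fst c \<Longrightarrow> transition c d (snd c p) = snd d p"
  by (simp add: transition_def)

lemma open_chart_image:
  assumes "c \<in> A" "openin M V" "V \<subseteq> fst c"
  shows "open (snd c ` V)"
proof -
  have "openin (subtopology M (fst c)) V"
    using assms by (simp add: openin_subtopology_Int2 openin_subset_topspace_eq openin_subtopology) blast
  then have "openin (top_of_set (snd c ` fst c)) (snd c ` V)"
    using homeomorphic_imp_open_map[OF chart_homeomorphic[OF assms(1)]] by (simp add: open_map_def)
  moreover have "open (snd c ` fst c)"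
    using chart_on[OF assms(1)] by (simp add: chart_on_def)
  ultimately show ?thesis
    using openin_open_trans by (simp add: openin_open_eq)
qed

lemma openin_chart_preimage:
  assumes "c \<in> A" "open B"
  shows "openin M {p \<in> fst c. snd c p \<in> B}"
proof -
  have "continuous_map (subtopology M (fst c)) euclidean (snd c)"
    using homeomorphic_imp_continuous_map[OF chart_homeomorphic[OF assms(1)]]
    by (simp add: continuous_map_in_subtopology)
  then have "openin (subtopology M (fst c)) {p \<in> topspace (subtopology M (fst c)). snd c p \<in> B}"
    using assms(2) by (intro openin_continuous_map_preimage) auto
  moreover have "{p \<in> topspace (subtopology M (fst c)). snd c p \<in> B} = {p \<in> fst c. snd c p \<in> B}"
    using chart_subset[OF assms(1)] by auto
  ultimately show ?thesis
    using openin_trans_full[OF _ openin_chart[OF assms(1)]] by simp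
qed

lemma smooth_on_transition:
  "c \<in> A \<Longrightarrow> d \<in> A \<Longrightarrow> smooth_on (transition c d) (snd c ` (fst c \<inter> fst d))"
  using smooth_manifold by (auto simp: smooth_manifold_def compatible_charts_def)

text \<open>Follows from maximality of the atlas. It supplies a coordinate system whose domain is
  exactly the neighbourhood \<open>U\<close> of the theorem.\<close>

lemma restrict_chart:
  assumes "c \<in> A" "openin M U" "U \<subseteq> fst c"
  shows "(U, snd c) \<in> A"
proof -
  have inv: "chart_inv (U, snd c) (snd c p) = p" if "p \<in> U" for p
    unfolding chart_inv_def using that inj_on_subset[OF chart_inj[OF assms(1)] assms(3)] by simp
  have "homeomorphic_map (subtopology M U) (top_of_set (snd c ` U)) (snd c)"
    using homeomorphic_map_subtopologies[OF chart_homeomorphic[OF assms(1)], of U "snd c ` U"]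
      assms(3) chart_subset[OF assms(1)] chart_inj[OF assms(1)]
    by (auto simp: subtopology_subtopology Int_absorb1 image_mono inj_on_def)
  then have "chart_on M (U, snd c)"
    using assms open_chart_image by (simp add: chart_on_def)
  moreover have "compatible_charts (U, snd c) d" if "d \<in> A" for d
    unfolding compatible_charts_def
  proof
    have "smooth_on (transition c d) (snd c ` (U \<inter> fst d))"
      using assms(3) by (intro smooth_on_subset[OF smooth_on_transition[OF assms(1) that]]) auto
    then have "smooth_on (transition (U, snd c) d) (snd c ` (U \<inter> fst d))"
      by (rule smooth_on_cong[rotated])
        (use assms that inv in \<open>auto simp: transition_def intro!: open_chart_image openin_Int openin_chart\<close>)
    then show "smooth_on (transition (U, snd c) d) (snd (U, snd c) ` (fst (U, snd c) \<inter> fst d))"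
      by simp
    have "smooth_on (transition d c) (snd d ` (U \<inter> fst d))"
      using assms(3) by (intro smooth_on_subset[OF smooth_on_transition[OF that assms(1)]]) auto
    then show "smooth_on (transition d (U, snd c)) (snd d ` (fst (U, snd c) \<inter> fst d))"
      by (simp add: transition_def)
  qed
  ultimately show ?thesis
    using smooth_manifold unfolding smooth_manifold_def by blast
qed

lemma transition_has_derivative:
  assumes "c \<in> A" "d \<in> A" "p \<in> fst c" "p \<in> fst d"
  shows "(transition c d has_derivative frechet_derivative (transition c d) (at (snd c p))) (at (snd c p))"
  using smooth_on_has_derivative[OF smooth_on_transition] assms by blast

text \<open>Chain rule for the cocycle identity of transition maps, which holds on the open image of
  the triple overlap. This makes the transformation law of tangent vectors consistent.\<close>

lemma transition_derivative_trans:
  assumes "c \<in> A" "d \<in> A" "e \<in> A" "p \<in> fst c" "p \<in> fst d" "p \<in> fst e"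
  shows "frechet_derivative (transition d e) (at (snd d p)) (frechet_derivative (transition c d) (at (snd c p)) w)
    = frechet_derivative (transition c e) (at (snd c p)) w"
proof -
  let ?V = "fst c \<inter> fst d \<inter> fst e"
  have "((\<lambda>x. transition d e (transition c d x)) has_derivative
      (\<lambda>w. frechet_derivative (transition d e) (at (snd d p)) (frechet_derivative (transition c d) (at (snd c p)) w)))
      (at (snd c p))"
    using has_derivative_compose[OF transition_has_derivative[of c d p]] transition_has_derivative[of d e p] assms
    by simp
  moreover have "open (snd c ` ?V)"
    using assms by (intro open_chart_image openin_Int openin_chart) auto
  moreover have "snd c p \<in> snd c ` ?V"
    using assms by blast
  ultimately have "(transition c e has_derivative
      (\<lambda>w. frechet_derivative (transition d e) (at (snd d p)) (frechet_derivative (transition c d) (at (snd c p)) w)))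
      (at (snd c p))"
    by (rule has_derivative_transform_within_open) (use assms in auto)
  from frechet_derivative_at[OF this] show ?thesis
    by metis
qed

lemma transition_derivative_self:
  assumes "c \<in> A" "p \<in> fst c"
  shows "frechet_derivative (transition c c) (at (snd c p)) w = w"
proof -
  have "(transition c c has_derivative (\<lambda>w. w)) (at (snd c p))"
    by (rule has_derivative_transform_within_open[OF has_derivative_ident, of "snd c ` fst c"])
      (use assms chart_on in \<open>auto simp: chart_on_def\<close>)
  from frechet_derivative_at[OF this] show ?thesis
    by metis
qed

lemma tangent_space_transition:
  assumes "v \<in> tangent_space A p" "c \<in> A" "d \<in> A" "p \<in> fst c" "p \<in> fst d"
  shows "v d = frechet_derivative (transition c d) (at (snd c p)) (v c)"
  using assms unfolding tangent_space_def by blast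

lemma tangent_space_outside: "v \<in> tangent_space A p \<Longrightarrow> \<not> (c \<in> A \<and> p \<in> fst c) \<Longrightarrow> v c = 0"
  unfolding tangent_space_def by blast

text \<open>The transformation law determines a vector from its components in one chart. Conversely,
  any \<open>w\<close> is spread to the other charts by the transition derivatives, and the cocycle
  identity shows that the law holds. Hence \<open>tvec_of\<close> is a true inverse of reading
  components.\<close>

lemma bij_betw_tangent_space:
  assumes "c \<in> A" "p \<in> fst c"
  shows "bij_betw (\<lambda>v. v c) (tangent_space A p) UNIV"
  unfolding bij_betw_def
proof
  show "inj_on (\<lambda>v. v c) (tangent_space A p)"
  proof (intro inj_onI ext)
    fix v w d
    assume *: "v \<in> tangent_space A p" "w \<in> tangent_space A p" "v c = w c"
    show "v d = w d"
    proof (cases "d \<in> A \<and> p \<in> fst d")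
      case True
      then show ?thesis
        using * assms tangent_space_transition by metis
    next
      case False
      then show ?thesis
        using * tangent_space_outside by metis
    qed
  qed
  show "(\<lambda>v. v c) ` tangent_space A p = UNIV"
  proof (intro equalityI subsetI)
    fix w :: "real^'n"
    define v where "v d = (if d \<in> A \<and> p \<in> fst d
      then frechet_derivative (transition c d) (at (snd c p)) w else 0)" for d
    have "v \<in> tangent_space A p"
      unfolding tangent_space_def v_def using assms transition_derivative_trans by auto
    moreover have "v c = w"
      using assms by (simp add: v_def transition_derivative_self)
    ultimately show "w \<in> (\<lambda>v. v c) ` tangent_space A p"
      by blast
  qed simp
qed

lemma tvec_of_in:
  "c \<in> A \<Longrightarrow> p \<in> fst c \<Longrightarrow> tvec_of A c p w \<in> tangent_space A p"
  unfolding tvec_of_def using bij_betw_tangent_space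
  by (metis UNIV_I bij_betw_imp_surj_on inv_into_into)

lemma tvec_of_apply [simp]: "c \<in> A \<Longrightarrow> p \<in> fst c \<Longrightarrow> tvec_of A c p w c = w"
  unfolding tvec_of_def using bij_betw_inv_into_right[OF bij_betw_tangent_space] by fastforce

lemma tvec_of_eqI:
  "c \<in> A \<Longrightarrow> p \<in> fst c \<Longrightarrow> v \<in> tangent_space A p \<Longrightarrow> tvec_of A c p (v c) = v"
  unfolding tvec_of_def by (rule bij_betw_inv_into_left[OF bij_betw_tangent_space])

lemma tvec_of_transition:
  assumes "c \<in> A" "d \<in> A" "p \<in> fst c" "p \<in> fst d"
  shows "tvec_of A c p w d = frechet_derivative (transition c d) (at (snd c p)) w"
  using tangent_space_transition[OF tvec_of_in] assms by simp

lemma tvec_of_scaleR: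
  assumes "c \<in> A" "p \<in> fst c"
  shows "tvec_of A c p (t *\<^sub>R w) = (\<lambda>d. t *\<^sub>R tvec_of A c p w d)"
proof
  fix d
  show "tvec_of A c p (t *\<^sub>R w) d = t *\<^sub>R tvec_of A c p w d"
  proof (cases "d \<in> A \<and> p \<in> fst d")
    case True
    then have "linear (frechet_derivative (transition c d) (at (snd c p)))"
      using transition_has_derivative[of c d p] assms has_derivative_linear by blast
    then show ?thesis
      using True assms by (simp add: tvec_of_transition linear_scale)
  next
    case False
    then show ?thesis
      using tangent_space_outside[OF tvec_of_in[OF assms]] by simp
  qed
qed

lemma tvec_of_eq_0_iff:
  assumes "c \<in> A" "p \<in> fst c"
  shows "tvec_of A c p w = (\<lambda>_. 0) \<longleftrightarrow> w = 0"
  \<comment> \<open>Homogeneity with factor 0 shows that zero components give the zero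
    vector.\<close>
  using tvec_of_scaleR[OF assms, of 0 0] tvec_of_apply[OF assms, of w] by auto


section \<open>The topology of the tangent bundle\<close>

lemma topspace_tangent_topology: "topspace (tangent_topology M A) = tangent_bundle M A"
proof -
  let ?G = "{{z \<in> tangent_bundle M A. fst z \<in> fst c \<and> natural_coords c z \<in> O'} | c O'. c \<in> A \<and> open O'}"
  have "z \<in> \<Union>?G" if z: "z \<in> tangent_bundle M A" for z
  proof -
    have "fst z \<in> \<Union>(fst ` A)"
      using z smooth_manifold by (auto simp: tangent_bundle_def smooth_manifold_def)
    then obtain c where c: "c \<in> A" "fst z \<in> fst c"
      by blast
    have "{z \<in> tangent_bundle M A. fst z \<in> fst c \<and> natural_coords c z \<in> UNIV} \<in> ?G"
      using c(1) open_UNIV by blast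
    then show ?thesis
      by (rule UnionI) (use z c(2) in simp)
  qed
  then show ?thesis
    unfolding tangent_topology_def topology_generated_by_topspace by (intro equalityI subsetI) auto
qed

lemma openin_tangent_topology_chart:
  "c \<in> A \<Longrightarrow> open B \<Longrightarrow>
    openin (tangent_topology M A) {z \<in> tangent_bundle M A. fst z \<in> fst c \<and> natural_coords c z \<in> B}"
  unfolding tangent_topology_def by (rule topology_generated_by_Basis) blast

lemma continuous_map_into_tangent_topology:
  assumes "f ` topspace X \<subseteq> tangent_bundle M A"
    and "\<And>c B. c \<in> A \<Longrightarrow> open B \<Longrightarrow>
      openin X {u \<in> topspace X. fst (f u) \<in> fst c \<and> natural_coords c (f u) \<in> B}"
  shows "continuous_map X (tangent_topology M A) f"
  unfolding tangent_topology_def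
proof (rule continuous_on_generated_topo)
  let ?G = "{{z \<in> tangent_bundle M A. fst z \<in> fst c \<and> natural_coords c z \<in> O'} | c O'. c \<in> A \<and> open O'}"
  show "f ` topspace X \<subseteq> \<Union>?G"
    using assms(1) topspace_tangent_topology
    unfolding tangent_topology_def topology_generated_by_topspace by blast
  fix V assume "V \<in> ?G"
  then obtain c B where cB: "c \<in> A" "open B"
    and V: "V = {z \<in> tangent_bundle M A. fst z \<in> fst c \<and> natural_coords c z \<in> B}"
    by blast
  have "f -` V \<inter> topspace X = {u \<in> topspace X. fst (f u) \<in> fst c \<and> natural_coords c (f u) \<in> B}"
    unfolding V using assms(1) by blast
  then show "openin X (f -` V \<inter> topspace X)"
    using assms(2)[OF cB] by simp
qed

lemma tvec_of_in_tangent_bundle: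
  "c \<in> A \<Longrightarrow> p \<in> fst c \<Longrightarrow> (p, tvec_of A c p w) \<in> tangent_bundle M A"
  using tvec_of_in[of c p w] chart_subset[of c] by (auto simp: tangent_bundle_def)

text \<open>Over a fixed base point, a parametrisation \<open>e\<close> of component vectors with
  continuous left inverse \<open>h\<close> yields an embedding into the tangent bundle; the inverse
  reads off the components in \<open>c\<close> and then applies \<open>h\<close>.\<close>

lemma embedding_map_fibre:
  fixes e :: "'b::topological_space \<Rightarrow> real^'n"
  assumes c: "c \<in> A" "p \<in> fst c"
    and e: "continuous_on C e"
    and h: "continuous_on (e ` C) h" "\<And>u. u \<in> C \<Longrightarrow> h (e u) = u"
    and S: "\<And>u. u \<in> C \<Longrightarrow> (p, tvec_of A c p (e u)) \<in> S"
  shows "embedding_map (top_of_set C) (subtopology (tangent_topology M A) S)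
    (\<lambda>u. (p, tvec_of A c p (e u)))"
proof -
  define f where "f u = (p, tvec_of A c p (e u))" for u
  have fTB: "f ` C \<subseteq> tangent_bundle M A"
    using tvec_of_in_tangent_bundle[OF c] by (auto simp: f_def)
  have S': "S \<inter> f ` C = f ` C"
    using S by (auto simp: f_def)
  \<comment> \<open>In a chart \<open>d\<close> around \<open>p\<close> the components are a fixed
    linear map applied to \<open>e u\<close>; a chart missing \<open>p\<close> contributes an empty
    preimage.\<close>
  have "continuous_map (top_of_set C) (tangent_topology M A) f"
  proof (rule continuous_map_into_tangent_topology)
    fix d B assume d: "d \<in> A" and B: "open (B :: ((real^'n) \<times> (real^'n)) set)"
    show "openin (top_of_set C) {u \<in> topspace (top_of_set C). fst (f u) \<in> fst d \<and> natural_coords d (f u) \<in> B}"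
    proof (cases "p \<in> fst d")
      case True
      have "bounded_linear (frechet_derivative (transition c d) (at (snd c p)))"
        using transition_has_derivative[OF c(1) d c(2) True] has_derivative_bounded_linear by blast
      then have "continuous_on C (\<lambda>u. frechet_derivative (transition c d) (at (snd c p)) (e u))"
        using e bounded_linear.continuous_on by blast
      then have "continuous_on C (\<lambda>u. (snd d p, frechet_derivative (transition c d) (at (snd c p)) (e u)))"
        by (intro continuous_intros)
      from continuous_openin_preimage_gen[OF this B] True show ?thesis
        by (simp add: f_def natural_coords_def tvec_of_transition[OF c(1) d c(2)] vimage_def Collect_conj_eq)
    qed (simp add: f_def)
  qed (use fTB in simp)
  moreover have "continuous_map (subtopology (tangent_topology M A) (f ` C)) (top_of_set (e ` C)) (\<lambda>z. snd z c)"
    unfolding continuous_map_in_subtopology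
  proof
    show "continuous_map (subtopology (tangent_topology M A) (f ` C)) euclidean (\<lambda>z. snd z c)"
      unfolding continuous_map_def
    proof (intro conjI allI impI)
      fix B assume "openin euclidean (B :: (real^'n) set)"
      then have "open (UNIV \<times> B :: ((real^'n) \<times> (real^'n)) set)"
        by (simp add: open_Times)
      from openin_tangent_topology_chart[OF c(1) this]
      have "openin (subtopology (tangent_topology M A) (f ` C))
        ({z \<in> tangent_bundle M A. fst z \<in> fst c \<and> natural_coords c z \<in> UNIV \<times> B} \<inter> f ` C)"
        by (rule openin_subtopology_Int)
      moreover have "{z \<in> tangent_bundle M A. fst z \<in> fst c \<and> natural_coords c z \<in> UNIV \<times> B} \<inter> f ` C
        = {z \<in> topspace (subtopology (tangent_topology M A) (f ` C)). snd z c \<in> B}"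
        using c(2) by (auto simp: topspace_tangent_topology natural_coords_def f_def)
      ultimately show "openin (subtopology (tangent_topology M A) (f ` C))
          {z \<in> topspace (subtopology (tangent_topology M A) (f ` C)). snd z c \<in> B}"
        by simp
    qed simp
    show "(\<lambda>z. snd z c) \<in> topspace (subtopology (tangent_topology M A) (f ` C)) \<rightarrow> e ` C"
      using c by (auto simp: f_def)
  qed
  then have "continuous_map (subtopology (tangent_topology M A) (f ` C)) (top_of_set C) (h \<circ> (\<lambda>z. snd z c))"
    by (rule continuous_map_compose) (use h in \<open>auto simp: continuous_map_in_subtopology\<close>)
  ultimately have "homeomorphic_maps (top_of_set C) (subtopology (tangent_topology M A) (f ` C)) f (h \<circ> (\<lambda>z. snd z c))"
    unfolding homeomorphic_maps_def using c h(2)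
    by (auto simp: continuous_map_in_subtopology f_def)
  then have "embedding_map (top_of_set C) (subtopology (tangent_topology M A) S) f"
    unfolding embedding_map_def homeomorphic_map_maps by (auto simp: subtopology_subtopology S')
  then show ?thesis
    unfolding f_def .
qed

text \<open>Carries joint smoothness in point and parameter from components in \<open>c\<close> to
  components in \<open>d\<close>. The base point is moved by \<open>?T\<close>, and the components
  by the transition derivative at the moved point. Since its argument varies too, it is expanded in
  the basis as in the chain rule.\<close>

lemma smooth_on_field_coords:
  fixes e :: "(real^'n) \<times> 'b::euclidean_space \<Rightarrow> real^'n"
  assumes c: "c \<in> A" and d: "d \<in> A"
    and V: "openin M V" "V \<subseteq> fst c" "V \<subseteq> fst d" and B: "open B"
    and e: "smooth_on e (snd c ` V \<times> B)"
  shows "smooth_on (\<lambda>(x, u). field_coords d (\<lambda>p. tvec_of A c p (e (snd c p, u))) x) (snd d ` V \<times> B)"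
proof -
  let ?T = "transition d c" and ?D = "\<lambda>x. frechet_derivative (transition c d) (at x)"
  let ?S = "snd d ` V \<times> B"
  have S: "open ?S"
    using open_chart_image[OF d] V B by (auto intro: open_Times)
  have T: "smooth_on (\<lambda>z. ?T (fst z)) ?S"
    using V by (intro smooth_on_compose[OF S _ smooth_on_transition[OF d c]] smooth_on_bounded_linear[OF S]
        bounded_linear_fst) auto
  have T_in: "?T (snd d p) = snd c p" if "p \<in> V" for p
    using that V d by auto
  have "smooth_on (\<lambda>z. (?T (fst z), snd z)) ?S"
    by (intro smooth_on_Pair S T smooth_on_bounded_linear bounded_linear_snd)
  then have E: "smooth_on (\<lambda>z. e (?T (fst z), snd z)) ?S"
    by (rule smooth_on_compose[OF S _ e]) (use T_in in auto)
  have "smooth_on (\<lambda>z. ?D (?T (fst z)) b) ?S" for b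
    using V T_in by (intro smooth_on_compose[OF S T smooth_on_frechet_derivative[OF smooth_on_transition[OF c d]]]) auto
  moreover have "smooth_on (\<lambda>z. e (?T (fst z), snd z) \<bullet> b) ?S" for b
    by (rule smooth_on_bounded_linear_compose[OF S bounded_linear_inner_left E])
  ultimately have "smooth_on (\<lambda>z. \<Sum>b\<in>Basis. (e (?T (fst z), snd z) \<bullet> b) *\<^sub>R ?D (?T (fst z)) b) ?S"
    by (intro smooth_on_sum[OF S] smooth_on_scaleR[OF S])
  then show ?thesis
  proof (rule smooth_on_cong[OF S])
    fix z assume "z \<in> ?S"
    then obtain p u where z: "z = (snd d p, u)" and p: "p \<in> V"
      by auto
    then have pc: "p \<in> fst c" and pd: "p \<in> fst d"
      using V by auto
    let ?w = "e (snd c p, u)"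
    interpret D: linear "?D (snd c p)"
      using transition_has_derivative[OF c d pc pd] by (rule has_derivative_linear)
    have "?D (snd c p) ?w = ?D (snd c p) (\<Sum>b\<in>Basis. (?w \<bullet> b) *\<^sub>R b)"
      by (simp only: euclidean_representation)
    also have "\<dots> = (\<Sum>b\<in>Basis. (?w \<bullet> b) *\<^sub>R ?D (snd c p) b)"
      by (simp only: D.sum D.scale)
    finally show "(\<Sum>b\<in>Basis. (e (?T (fst z), snd z) \<bullet> b) *\<^sub>R ?D (?T (fst z)) b)
        = (case z of (x, u) \<Rightarrow> field_coords d (\<lambda>p. tvec_of A c p (e (snd c p, u))) x)"
      using pc pd c d by (simp add: z field_coords_def tvec_of_transition)
  qed
qed

end


section \<open>Unit fields for the maximum of Finsler structures\<close>

text \<open>A gradient of maximal norm wins: along it, its own function grows strictly faster than all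
  the others.\<close>

lemma exists_strictly_dominant_point:
  fixes f :: "'i \<Rightarrow> 'a::euclidean_space \<Rightarrow> real"
  assumes I: "finite I" "I \<noteq> {}"
    and f: "\<And>i. i \<in> I \<Longrightarrow> (f i has_derivative L i) (at y)"
    and eq: "\<And>i j. i \<in> I \<Longrightarrow> j \<in> I \<Longrightarrow> f i y = f j y"
    and L: "inj_on L I" and y: "y \<noteq> 0"
  obtains i y' where "i \<in> I" "y' \<noteq> 0" "\<And>j. j \<in> I - {i} \<Longrightarrow> f j y' < f i y'"
proof -
  \<comment> \<open>The gradient: the vector that represents \<open>L i\<close> through the inner
    product.\<close>
  define g where "g i = (\<Sum>b\<in>Basis. L i b *\<^sub>R b)" for i
  have Lg: "L i w = g i \<bullet> w" if "i \<in> I" for i w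
  proof -
    interpret L: linear "L i"
      using f[OF that] by (rule has_derivative_linear)
    have "L i w = L i (\<Sum>b\<in>Basis. (w \<bullet> b) *\<^sub>R b)"
      by (simp only: euclidean_representation)
    also have "\<dots> = (\<Sum>b\<in>Basis. (w \<bullet> b) *\<^sub>R L i b)"
      by (simp only: L.sum L.scale)
    finally show ?thesis
      by (simp add: g_def inner_sum_left inner_commute[of w] mult.commute)
  qed
  have "inj_on g I"
    using L Lg by (auto simp: inj_on_def fun_eq_iff)
  have "Max ((\<lambda>i. norm (g i)) ` I) \<in> (\<lambda>i. norm (g i)) ` I"
    using I by (intro Max_in) auto
  then obtain i where i: "i \<in> I" and "Max ((\<lambda>i. norm (g i)) ` I) = norm (g i)"
    by blast
  then have max: "norm (g j) \<le> norm (g i)" if "j \<in> I" for j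
    using Max_ge[of "(\<lambda>i. norm (g i)) ` I" "norm (g j)"] I that by simp
  have gj: "g j \<bullet> g i < g i \<bullet> g i" if "j \<in> I - {i}" for j
  proof -
    \<comment> \<open>Expanding this square and bounding the squared norm of \<open>g j\<close> by
      that of \<open>g i\<close> leaves twice the claimed strict inequality.\<close>
    have "0 < (g i - g j) \<bullet> (g i - g j)"
      using that i \<open>inj_on g I\<close> by (auto simp: inj_on_def)
    moreover have "g j \<bullet> g j \<le> g i \<bullet> g i"
      using max[of j] that by (simp add: norm_le)
    ultimately show ?thesis
      by (simp add: inner_diff_left inner_diff_right inner_commute)
  qed
  have "\<forall>\<^sub>F t in at_right 0. f j (y + t *\<^sub>R g i) < f i (y + t *\<^sub>R g i)" if j: "j \<in> I - {i}" for j
  proof -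
    \<comment> \<open>The difference vanishes at 0 because all functions agree at \<open>y\<close>,
      and has positive slope there; so it is positive for small \<open>t > 0\<close>. Finiteness of
      \<open>I\<close> then permits one \<open>t\<close> for all \<open>j\<close>.\<close>
    let ?h = "\<lambda>t. f i (y + t *\<^sub>R g i) - f j (y + t *\<^sub>R g i)"
    have line: "((\<lambda>t. y + t *\<^sub>R g i) has_derivative (\<lambda>t. t *\<^sub>R g i)) (at 0)"
      by (auto intro!: derivative_eq_intros)
    have "((\<lambda>t. f l (y + t *\<^sub>R g i)) has_derivative (\<lambda>t. L l (t *\<^sub>R g i))) (at 0)" if "l \<in> I" for l
      using has_derivative_compose[OF line, of "f l" "L l"] f[OF that] by simp
    then have "(?h has_derivative (\<lambda>t. L i (t *\<^sub>R g i) - L j (t *\<^sub>R g i))) (at 0)"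
      using i j by (intro has_derivative_diff) auto
    then have "(?h has_real_derivative (g i \<bullet> g i - g j \<bullet> g i)) (at 0)"
      unfolding has_field_derivative_def
      by (rule has_derivative_eq_rhs) (use i j in \<open>auto simp: fun_eq_iff Lg algebra_simps\<close>)
    then obtain \<delta> where "\<delta> > 0" "\<And>t. 0 < t \<Longrightarrow> t < \<delta> \<Longrightarrow> ?h 0 < ?h t"
      using DERIV_pos_inc_right[of ?h "g i \<bullet> g i - g j \<bullet> g i" 0] gj[OF j] by auto
    moreover have "?h 0 = 0"
      using eq[of i j] i j by simp
    ultimately show ?thesis
      unfolding eventually_at_right_field by (intro exI[of _ \<delta>]) force
  qed
  then have "\<forall>\<^sub>F t in at_right 0. \<forall>j\<in>I - {i}. f j (y + t *\<^sub>R g i) < f i (y + t *\<^sub>R g i)"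
    using I by (intro eventually_ball_finite) auto
  moreover have "((\<lambda>t. y + t *\<^sub>R g i) \<longlongrightarrow> y + 0 *\<^sub>R g i) (at_right 0)"
    by (intro tendsto_intros)
  then have "\<forall>\<^sub>F t in at_right 0. y + t *\<^sub>R g i \<noteq> 0"
    using y by (intro tendsto_imp_eventually_ne) auto
  ultimately have "\<forall>\<^sub>F t in at_right 0. (\<forall>j\<in>I - {i}. f j (y + t *\<^sub>R g i) < f i (y + t *\<^sub>R g i)) \<and> y + t *\<^sub>R g i \<noteq> 0"
    by (rule eventually_conj)
  then obtain t :: real where "\<forall>j\<in>I - {i}. f j (y + t *\<^sub>R g i) < f i (y + t *\<^sub>R g i)" "y + t *\<^sub>R g i \<noteq> 0"
    using eventually_happens'[of "at_right (0::real)"] by auto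
  then show thesis
    using that i by blast
qed

lemma continuous_on_infnorm: "continuous_on S infnorm"
  unfolding continuous_on by (auto intro: tendsto_infnorm)

theorem lemma9p11:
  fixes M :: "'a topology"
    and A :: "('a, 'n::finite) chart set"
    and F :: "nat \<Rightarrow> 'a \<times> ('a, 'n) tvec \<Rightarrow> real"
    and k :: nat
    and x0 :: 'a and y0 :: "('a, 'n) tvec"
    and W :: "('a \<times> ('a, 'n) tvec) set"
  assumes "smooth_manifold M A"
    and "k \<ge> 1"
    and "\<And>i. i \<in> {1..k} \<Longrightarrow> finsler_structure M A (F i)"
    and "(x0, y0) \<in> tangent_bundle M A"
    and "\<And>i. i \<in> {1..k} \<Longrightarrow> F i (x0, y0) = 1"
    and "W \<subseteq> tangent_bundle M A"
    and "\<exists>N. openin (tangent_topology M A) N \<and> (x0, y0) \<in> N \<and> N \<subseteq> W"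
    and "finsler_independent A F k W"
  shows "\<exists>(C :: (real^'n) set) U (X :: real^'n \<Rightarrow> 'a \<Rightarrow> ('a, 'n) tvec).
      C \<subseteq> max_sphere \<and>
      (top_of_set max_sphere) interior_of C \<noteq> {} \<and>
      openin M U \<and> x0 \<in> U \<and>
      (\<forall>u\<in>C. smooth_vector_field A U (X u) \<and>
         (\<forall>x\<in>U. (x, X u x) \<in> unit_tangent_sphere A (finsler_max F k) x)) \<and>
      (\<forall>x\<in>U. embedding_map (top_of_set C)
         (subtopology (tangent_topology M A) (unit_tangent_sphere A (finsler_max F k) x))
         (\<lambda>u. (x, X u x))) \<and>
      (\<exists>\<phi>. (U, \<phi>) \<in> A) \<and>
      (\<forall>\<phi>. (U, \<phi>) \<in> A \<longrightarrow>
         continuous_on (\<phi> ` U \<times> C) (\<lambda>(x, u). field_coords (U, \<phi>) (X u) x) \<and>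
         (\<forall>i. continuous_on (\<phi> ` U \<times> C)
            (\<lambda>(x, u). partial_deriv i (field_coords (U, \<phi>) (X u)) x)))"
proof -

  \<comment> \<open>The Finsler structures in a chart around the base point\<close>
  interpret manifold M A
    by unfold_locales fact
  have finsler: "\<And>c. c \<in> A \<Longrightarrow> smooth_on (local_rep A c (F j)) ((snd c ` fst c) \<times> (- {0}))"
      "\<And>p. p \<in> topspace M \<Longrightarrow> asymmetric_norm_on (tangent_space A p) (\<lambda>y. F j (p, y))"
    if "j \<in> {1..k}" for j
    using assms(3)[OF that] by (auto simp: finsler_structure_def)
  have x0: "x0 \<in> topspace M" and y0: "y0 \<in> tangent_space A x0"
    using assms(4) by (auto simp: tangent_bundle_def)
  then obtain c where c: "c \<in> A" and x0c: "x0 \<in> fst c"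
    using assms(1) unfolding smooth_manifold_def by blast
  define \<Omega> where "\<Omega> = snd c ` fst c"
  define G where "G j = local_rep A c (F j)" for j
  have open_\<Omega>: "open \<Omega>"
    unfolding \<Omega>_def using open_chart_image[OF c openin_chart[OF c]] by simp
  have G: "G j (snd c p, w) = F j (p, tvec_of A c p w)" if "p \<in> fst c" for j p w
    using that c by (simp add: G_def local_rep_def)
  have smooth_G: "smooth_on (G j) (\<Omega> \<times> - {0})" if "j \<in> {1..k}" for j
    unfolding G_def \<Omega>_def by (rule finsler(1)[OF that c])
  have norm: "asymmetric_norm_on (tangent_space A p) (\<lambda>y. F j (p, y))"
    if "j \<in> {1..k}" "p \<in> fst c" for j p
    using finsler(2)[OF that(1)] that(2) chart_subset[OF c] by blast
  have G_pos: "G j (snd c p, w) > 0" if "j \<in> {1..k}" "p \<in> fst c" "w \<noteq> 0" for j p w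
    using norm[OF that(1,2)] tvec_of_in[OF c that(2), of w] tvec_of_eq_0_iff[OF c that(2), of w] that
    unfolding asymmetric_norm_on_def by (metis G order_less_le)
  have G_scale: "G j (snd c p, t *\<^sub>R w) = t * G j (snd c p, w)" if "j \<in> {1..k}" "p \<in> fst c" "t > 0" for j p t w
    using norm[OF that(1,2)] tvec_of_in[OF c that(2), of w] tvec_of_scaleR[OF c that(2), of t w] that
    unfolding asymmetric_norm_on_def by (simp add: G)

  \<comment> \<open>A direction in which one structure dominates\<close>
  have "(x0, y0) \<in> W"
    using assms(7) by blast
  then obtain L where
    L: "\<And>i. i \<in> {1..k} \<Longrightarrow> has_fibre_differential A x0 (\<lambda>y'. F i (x0, y')) (L i) y0"
    and indep: "\<And>a. \<forall>v\<in>tangent_space A x0. (\<Sum>i=1..k. a i * L i v) = 0 \<Longrightarrow> \<forall>i\<in>{1..k}. a i = 0"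
    using assms(8) unfolding finsler_independent_def by blast
  have one: "1 \<in> {1..k}"
    using assms(2) by simp
  have "F 1 (x0, y0) = 0 \<longleftrightarrow> y0 = (\<lambda>_. 0)"
    using norm[OF one x0c] y0 unfolding asymmetric_norm_on_def by blast
  then have "tvec_of A c x0 (y0 c) \<noteq> (\<lambda>_. 0)"
    using assms(5)[OF one] tvec_of_eqI[OF c x0c y0] by simp
  then have y0c: "y0 c \<noteq> 0"
    using tvec_of_eq_0_iff[OF c x0c] by blast
  \<comment> \<open>Two equal differentials would satisfy the relation with coefficient 1 at
    \<open>i\<close>, -1 at \<open>j\<close> and 0 elsewhere, against independence.\<close>
  have inj: "inj_on (\<lambda>i w. L i (tvec_of A c x0 w)) {1..k}"
  proof (rule inj_onI, rule ccontr)
    fix i j assume ij: "i \<in> {1..k}" "j \<in> {1..k}" "i \<noteq> j"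
      and eq: "(\<lambda>w. L i (tvec_of A c x0 w)) = (\<lambda>w. L j (tvec_of A c x0 w))"
    define a :: "nat \<Rightarrow> real" where "a l = of_bool (l = i) - of_bool (l = j)" for l
    have "(\<Sum>l=1..k. a l * L l v) = 0" if "v \<in> tangent_space A x0" for v
    proof -
      have "(\<Sum>l=1..k. a l * L l v) = L i v - L j v"
        using ij by (simp add: a_def left_diff_distrib sum_subtractf of_bool_def if_distrib[of "\<lambda>x. x * _"] sum.delta cong: if_cong)
      also have "\<dots> = 0"
        using fun_cong[OF eq, of "v c"] by (simp add: tvec_of_eqI[OF c x0c that])
      finally show ?thesis .
    qed
    then have "a i = 0"
      using indep[of a] ij(1) by blast
    then show False
      using ij(3) by (simp add: a_def)
  qed
  have deriv: "((\<lambda>w. G i (snd c x0, w)) has_derivative (\<lambda>w. L i (tvec_of A c x0 w))) (at (y0 c))"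
    if "i \<in> {1..k}" for i
    using L[OF that] c x0c unfolding has_fibre_differential_def by (simp add: G)
  have "G i (snd c x0, y0 c) = G j (snd c x0, y0 c)" if "i \<in> {1..k}" "j \<in> {1..k}" for i j
    using assms(5)[OF that(1)] assms(5)[OF that(2)] by (simp add: G x0c tvec_of_eqI[OF c x0c y0])
  from exists_strictly_dominant_point[OF _ _ deriv this inj y0c] one
  obtain i y1 where i: "i \<in> {1..k}" and y1: "y1 \<noteq> 0"
    and y1_less: "\<And>j. j \<in> {1..k} - {i} \<Longrightarrow> G j (snd c x0, y1) < G i (snd c x0, y1)"
    by (metis empty_iff finite_atLeastAtMost)

  \<comment> \<open>Dominance near the chosen direction\<close>
  define u1 where "u1 = inverse (infnorm y1) *\<^sub>R y1"
  have "infnorm y1 > 0"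
    using y1 by (simp add: infnorm_pos_lt)
  then have u1: "u1 \<noteq> 0" "infnorm u1 = 1"
    using y1 by (auto simp: u1_def infnorm_mul)
  \<comment> \<open>Both sides scale by the same positive factor, so moving \<open>y1\<close> onto
    the maximum norm sphere keeps the inequality.\<close>
  have u1_less: "G j (snd c x0, u1) < G i (snd c x0, u1)" if "j \<in> {1..k} - {i}" for j
    using y1_less[OF that] that i \<open>infnorm y1 > 0\<close> by (simp add: u1_def G_scale x0c)
  have "open ((\<Omega> \<times> - {0}) \<inter> (\<lambda>z. G i z - G j z) -` {0<..})" if "j \<in> {1..k}" for j
    using smooth_on_imp_continuous_on[OF smooth_G[OF i]] smooth_on_imp_continuous_on[OF smooth_G[OF that]] open_\<Omega>
    by (intro continuous_open_preimage continuous_on_diff) (auto intro: open_Times)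
  \<comment> \<open>The outer factor \<open>\<Omega> \<times> - {0}\<close> matters for
    \<open>k = 1\<close>, where the intersection over \<open>j\<close> is the whole space.\<close>
  then have "open ((\<Omega> \<times> - {0}) \<inter> (\<Inter>j\<in>{1..k} - {i}. (\<Omega> \<times> - {0}) \<inter> (\<lambda>z. G i z - G j z) -` {0<..}))"
    using open_\<Omega> by (intro open_Int open_INT) (auto intro: open_Times)
  moreover have "(snd c x0, u1) \<in> (\<Omega> \<times> - {0}) \<inter> (\<Inter>j\<in>{1..k} - {i}. (\<Omega> \<times> - {0}) \<inter> (\<lambda>z. G i z - G j z) -` {0<..})"
    using x0c u1 u1_less by (auto simp: \<Omega>_def)
  ultimately obtain B V where B: "open B" and V: "open V" and x0B: "snd c x0 \<in> B" and u1V: "u1 \<in> V"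
    and BV: "B \<times> V \<subseteq> (\<Omega> \<times> - {0}) \<inter> (\<Inter>j\<in>{1..k} - {i}. (\<Omega> \<times> - {0}) \<inter> (\<lambda>z. G i z - G j z) -` {0<..})"
    by (rule open_prod_elim) blast
  have B\<Omega>: "B \<times> V \<subseteq> \<Omega> \<times> - {0}" and V0: "0 \<notin> V"
    using BV x0B by blast+
  have less: "G j (x, u) < G i (x, u)" if "x \<in> B" "u \<in> V" "j \<in> {1..k}" "j \<noteq> i" for x u j
  proof -
    have "(x, u) \<in> (\<lambda>z. G i z - G j z) -` {0<..}"
      using BV that by blast
    then show ?thesis
      by simp
  qed

  \<comment> \<open>The control region and the unit fields\<close>
  define C where "C = max_sphere \<inter> V"
  define U where "U = {p \<in> fst c. snd c p \<in> B}"
  \<comment> \<open>By homogeneity this factor gives the vector with components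
    \<open>e (x, u)\<close> the value 1 under the dominant \<open>F i\<close>.\<close>
  define e where "e z = inverse (G i z) *\<^sub>R snd z" for z :: "(real^'n) \<times> (real^'n)"
  define X where "X u p = tvec_of A c p (e (snd c p, u))" for u p
  have U: "openin M U" "U \<subseteq> fst c" "x0 \<in> U"
    using openin_chart_preimage[OF c B] x0c x0B by (auto simp: U_def)
  have C: "C \<subseteq> V" "C \<subseteq> max_sphere"
    by (auto simp: C_def)
  have UV: "snd c ` U \<times> V \<subseteq> \<Omega> \<times> - {0}"
    using B\<Omega> by (auto simp: U_def \<Omega>_def)
  have pos: "G i (snd c p, u) > 0" if "p \<in> U" "u \<in> V" for p u
  proof -
    have "p \<in> fst c" "u \<noteq> 0"
      using that U(2) V0 by blast+
    then show ?thesis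
      by (rule G_pos[OF i])
  qed
  \<comment> \<open>Smoothness in \<open>u\<close> is proved on the open set \<open>V\<close>, since
    \<open>C\<close> lies in a sphere and is not open in the ambient space; continuity is restricted
    to \<open>C\<close> only at the end.\<close>
  have open_UV: "open (snd c ` U \<times> V)"
    by (intro open_Times open_chart_image[OF c U(1,2)] V)
  have smooth_e: "smooth_on e (snd c ` U \<times> V)"
    unfolding e_def
  proof (intro smooth_on_scaleR[OF open_UV])
    show "smooth_on (\<lambda>z. inverse (G i z)) (snd c ` U \<times> V)"
      using pos by (intro smooth_on_inverse[OF open_UV smooth_on_subset[OF smooth_G[OF i] UV]]) force
    show "smooth_on snd (snd c ` U \<times> V)"
      by (intro smooth_on_bounded_linear[OF open_UV] bounded_linear_snd)
  qed
  have X_in: "X u p \<in> tangent_space A p" if "p \<in> U" for u p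
    unfolding X_def using tvec_of_in[OF c] that U(2) by blast
  have smooth_X: "smooth_on (\<lambda>(x, u). field_coords d (X u) x) (snd d ` (U \<inter> fst d) \<times> V)" if "d \<in> A" for d
    unfolding X_def
    using U that by (intro smooth_on_field_coords c V openin_Int openin_chart smooth_on_subset[OF smooth_e]) auto
  have unit: "(p, X u p) \<in> unit_tangent_sphere A (finsler_max F k) p" if p: "p \<in> U" and u: "u \<in> V" for p u
  proof -
    have pc: "p \<in> fst c" and pB: "snd c p \<in> B"
      using p by (auto simp: U_def)
    have FX: "F j (p, X u p) = G j (snd c p, u) / G i (snd c p, u)" if "j \<in> {1..k}" for j
      using G_scale[OF that pc, of "inverse (G i (snd c p, u))" u] pos[OF p u]
      by (simp add: X_def e_def G[OF pc, symmetric] divide_inverse mult.commute)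
    \<comment> \<open>The values \<open>F j\<close> are quotients by \<open>G i\<close>: the index
      \<open>i\<close> attains 1, and dominance bounds the others by 1.\<close>
    have "finsler_max F k (p, X u p) = 1"
      unfolding finsler_max_def
    proof (rule Max_eqI)
      fix r assume "r \<in> (\<lambda>j. F j (p, X u p)) ` {1..k}"
      then obtain j where j: "j \<in> {1..k}" and r: "r = F j (p, X u p)"
        by blast
      have "G j (snd c p, u) \<le> G i (snd c p, u)"
        using less[OF pB u j] by (cases "j = i") auto
      then show "r \<le> 1"
        using pos[OF p u] by (simp add: r FX[OF j])
    next
      show "1 \<in> (\<lambda>j. F j (p, X u p)) ` {1..k}"
        using FX[OF i] i pos[OF p u] by (intro image_eqI[of _ _ i]) auto
    qed simp
    then show ?thesis
      using X_in[OF p] by (simp add: unit_tangent_sphere_def)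
  qed
  have "embedding_map (top_of_set C)
      (subtopology (tangent_topology M A) (unit_tangent_sphere A (finsler_max F k) p)) (\<lambda>u. (p, X u p))"
    if p: "p \<in> U" for p
    unfolding X_def
  proof (rule embedding_map_fibre[OF c])
    show "p \<in> fst c"
      using p U by blast
    have "continuous_on C (\<lambda>u. (snd c p, u))"
      by (intro continuous_intros)
    then show "continuous_on C (\<lambda>u. e (snd c p, u))"
      by (rule continuous_on_compose2[OF smooth_on_imp_continuous_on[OF smooth_e]]) (use p C in auto)
    have e0: "e (snd c p, u) \<noteq> 0" if "u \<in> C" for u
      using that pos[OF p, of u] C V0 by (auto simp: e_def)
    \<comment> \<open>This left inverse works because \<open>e (snd c p, u)\<close> is a positive
      multiple of \<open>u\<close>, whose maximum norm is 1.\<close>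
    then show "continuous_on ((\<lambda>u. e (snd c p, u)) ` C) (\<lambda>w. inverse (infnorm w) *\<^sub>R w)"
      by (intro continuous_intros continuous_on_infnorm) (auto simp: infnorm_eq_0)
    show "inverse (infnorm (e (snd c p, u))) *\<^sub>R e (snd c p, u) = u" if "u \<in> C" for u
    proof -
      have "u \<in> V" "infnorm u = 1"
        using that by (auto simp: C_def max_sphere_def)
      then show ?thesis
        using pos[OF p, of u] by (simp add: e_def infnorm_mul)
    qed
    show "(p, tvec_of A c p (e (snd c p, u))) \<in> unit_tangent_sphere A (finsler_max F k) p" if "u \<in> C" for u
      using unit[OF p, of u] that C by (auto simp: X_def)
  qed
  moreover have "smooth_vector_field A U (X u)" if "u \<in> V" for u
    unfolding smooth_vector_field_def
    using X_in smooth_on_slice[OF _ smooth_X that] U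
    by (auto intro!: open_chart_image openin_Int openin_chart)
  moreover have "continuous_on (\<phi> ` U \<times> C) (\<lambda>(x, u). field_coords (U, \<phi>) (X u) x) \<and>
      (\<forall>i. continuous_on (\<phi> ` U \<times> C) (\<lambda>(x, u). partial_deriv i (field_coords (U, \<phi>) (X u)) x))"
    if "(U, \<phi>) \<in> A" for \<phi>
  proof -
    have sub: "\<phi> ` U \<times> C \<subseteq> \<phi> ` U \<times> V"
      using C by blast
    \<comment> \<open>Joint smoothness holds in every chart of the atlas, hence for any coordinates
      on \<open>U\<close>, not only the restriction of \<open>c\<close>.\<close>
    have smooth: "smooth_on (\<lambda>(x, u). field_coords (U, \<phi>) (X u) x) (\<phi> ` U \<times> V)"
      using smooth_X[OF that] by simp
    have "continuous_on (\<phi> ` U \<times> V) (\<lambda>(x, u). partial_deriv i (field_coords (U, \<phi>) (X u)) x)" for i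
      using continuous_on_partial_deriv_slice[OF smooth, of i] by simp
    with smooth_on_imp_continuous_on[OF smooth] show ?thesis
      by (intro conjI allI continuous_on_subset[OF _ sub])
  qed
  moreover have "(U, snd c) \<in> A"
    by (rule restrict_chart[OF c U(1,2)])
  moreover have "openin (top_of_set max_sphere) C"
    unfolding C_def using V by (rule openin_open_Int)
  \<comment> \<open>Being relatively open, \<open>C\<close> is its own interior in the sphere, and
    it contains \<open>u1\<close>.\<close>
  then have "(top_of_set max_sphere) interior_of C \<noteq> {}"
    using u1 u1V by (auto simp: interior_of_openin C_def max_sphere_def)
  ultimately show ?thesis
    using C U unit by (intro exI[of _ C] exI[of _ U] exI[of _ X]) blast
qed

end
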